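(* $\dim_{\mathbb{k}} \mathrm{Cl}_q(n,k) = (8k)^n$.
   Context: Let $\mathbb{k}$ be a field of characteristic different from $2$, let $q\in\mathbb{k}^\times$, and let $n,k$ be positive integers. The quantum Clifford algebra $\mathrm{Cl}_q(n,k)$ is the unital associative $\mathbb{k}$-algebra generated by $\psi_a,\psi_a^*,\omega_a,\omega_a^{-1}$ for $a\in\{1,\dots,n\}$, subject to the relations (for all $a,b\in\{1,\dots,n\}$): $\omega_a\omega_b=\omega_b\omega_a$; $\omega_a\omega_a^{-1}=1$; $\omega_a\psi_b=q^{\delta_{ab}}\psi_b\omega_a$; $\omega_a\psi_b^*=q^{-\delta_{ab}}\psi_b^*\omega_a$; $\psi_a\psi_b+\psi_b\psi_a=0$; $\psi_a^*\psi_b^*+\psi_b^*\psi_a^*=0$; $\psi_a\psi_a^*+q^k\psi_a^*\psi_a=\omega_a^{-k}$; $\psi_a\psi_a^*+q^{-k}\psi_a^*\psi_a=\omega_a^{k}$; and $\psi_a\psi_b^*+\psi_b^*\psi_a=0$ if $a\neq b$. *)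

theory Defs
  imports Main
begin

text \<open>The free associative algebra over a field on the generators
  psi_a, psi_a^*, omega_a, omega_a^{-1} (a in {1..n}) is modelled concretely:
  elements are finitely supported coefficient functions on words (lists of
  generators), multiplication is concatenation extended bilinearly.\<close>

datatype gen = Psi nat | PsiS nat | Om nat | OmI nat

fun gen_idx :: "gen \<Rightarrow> nat" where
  "gen_idx (Psi a) = a" | "gen_idx (PsiS a) = a" | "gen_idx (Om a) = a" | "gen_idx (OmI a) = a"

definition Gens :: "nat \<Rightarrow> gen set" where
  "Gens n = {g. gen_idx g \<in> {1..n}}"

type_synonym 'a falg = "gen list \<Rightarrow> 'a"

definition FA :: "nat \<Rightarrow> ('a::field) falg set" where
  "FA n = {f. finite {w. f w \<noteq> 0} \<and> (\<forall>w. f w \<noteq> 0 \<longrightarrow> set w \<subseteq> Gens n)}"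

definition fzero :: "('a::field) falg" where "fzero = (\<lambda>_. 0)"
definition fone :: "('a::field) falg" where "fone = (\<lambda>w. if w = [] then 1 else 0)"
definition fgen :: "gen \<Rightarrow> ('a::field) falg" where "fgen g = (\<lambda>w. if w = [g] then 1 else 0)"
definition fadd :: "('a::field) falg \<Rightarrow> 'a falg \<Rightarrow> 'a falg" where "fadd f g = (\<lambda>w. f w + g w)"
definition fsub :: "('a::field) falg \<Rightarrow> 'a falg \<Rightarrow> 'a falg" where "fsub f g = (\<lambda>w. f w - g w)"
definition fsmul :: "'a::field \<Rightarrow> 'a falg \<Rightarrow> 'a falg" where "fsmul c f = (\<lambda>w. c * f w)"
definition fmul :: "('a::field) falg \<Rightarrow> 'a falg \<Rightarrow> 'a falg" where
  "fmul f g = (\<lambda>w. \<Sum>i\<le>length w. f (take i w) * g (drop i w))"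
definition fpow :: "('a::field) falg \<Rightarrow> nat \<Rightarrow> 'a falg" where
  "fpow f m = ((fmul f) ^^ m) fone"

inductive_set ideal_gen :: "nat \<Rightarrow> ('a::field) falg set \<Rightarrow> 'a falg set" for n R where
  base: "r \<in> R \<Longrightarrow> r \<in> ideal_gen n R"
| zero: "fzero \<in> ideal_gen n R"
| add: "x \<in> ideal_gen n R \<Longrightarrow> y \<in> ideal_gen n R \<Longrightarrow> fadd x y \<in> ideal_gen n R"
| smul: "x \<in> ideal_gen n R \<Longrightarrow> fsmul c x \<in> ideal_gen n R"
| lmul: "x \<in> ideal_gen n R \<Longrightarrow> f \<in> FA n \<Longrightarrow> fmul f x \<in> ideal_gen n R"
| rmul: "x \<in> ideal_gen n R \<Longrightarrow> f \<in> FA n \<Longrightarrow> fmul x f \<in> ideal_gen n R"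

definition Cl_rels :: "'a::field \<Rightarrow> nat \<Rightarrow> nat \<Rightarrow> 'a falg set" where
  "Cl_rels q n k =
    (let \<psi> = (\<lambda>a. fgen (Psi a)); \<psi>s = (\<lambda>a. fgen (PsiS a));
         \<omega> = (\<lambda>a. fgen (Om a)); \<omega>i = (\<lambda>a. fgen (OmI a));
         \<delta> = (\<lambda>a b::nat. if a = b then 1 else (0::nat)) in
    (\<Union>a\<in>{1..n}. \<Union>b\<in>{1..n}.
      { fsub (fmul (\<omega> a) (\<omega> b)) (fmul (\<omega> b) (\<omega> a)),
        fsub (fmul (\<omega> a) (\<omega>i a)) fone,
        fsub (fmul (\<omega>i a) (\<omega> a)) fone,
        fsub (fmul (\<omega> a) (\<psi> b)) (fsmul (q ^ \<delta> a b) (fmul (\<psi> b) (\<omega> a))),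
        fsub (fmul (\<omega> a) (\<psi>s b)) (fsmul (inverse q ^ \<delta> a b) (fmul (\<psi>s b) (\<omega> a))),
        fadd (fmul (\<psi> a) (\<psi> b)) (fmul (\<psi> b) (\<psi> a)),
        fadd (fmul (\<psi>s a) (\<psi>s b)) (fmul (\<psi>s b) (\<psi>s a)),
        fsub (fadd (fmul (\<psi> a) (\<psi>s a)) (fsmul (q ^ k) (fmul (\<psi>s a) (\<psi> a)))) (fpow (\<omega>i a) k),
        fsub (fadd (fmul (\<psi> a) (\<psi>s a)) (fsmul (inverse q ^ k) (fmul (\<psi>s a) (\<psi> a)))) (fpow (\<omega> a) k) }
      \<union> (if a \<noteq> b then { fadd (fmul (\<psi> a) (\<psi>s b)) (fmul (\<psi>s b) (\<psi> a)) } else {})))"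

definition Cl_ideal :: "'a::field \<Rightarrow> nat \<Rightarrow> nat \<Rightarrow> 'a falg set" where
  "Cl_ideal q n k = ideal_gen n (Cl_rels q n k)"

definition quotient_dim_eq :: "nat \<Rightarrow> ('a::field) falg set \<Rightarrow> nat \<Rightarrow> bool" where
  "quotient_dim_eq n I d \<longleftrightarrow>
    (\<exists>B. finite B \<and> B \<subseteq> FA n \<and> card B = d
      \<and> (\<forall>c. (\<lambda>w. \<Sum>b\<in>B. c b * b w) \<in> I \<longrightarrow> (\<forall>b\<in>B. c b = 0))
      \<and> (\<forall>f\<in>FA n. \<exists>c. fsub f (\<lambda>w. \<Sum>b\<in>B. c b * b w) \<in> I))"

end

theory Submission
  imports Defs "HOL.Vector_Spaces" "HOL-Library.FuncSet" "HOL-Library.Function_Algebras"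
begin

text \<open>For \<open>n = 1\<close> the algebra is \<open>M\<^sub>2(R)\<close> over the ground field \<open>F\<close>, \<open>R = F[x]/(x\<^sup>2\<^sup>k - 1)\<close>, via
  \<open>\<omega> = diag(x, q\<^sup>-\<^sup>1 x)\<close>, \<open>\<psi> = E\<^sub>0\<^sub>1\<close>, \<open>\<psi>\<^sup>* = x\<^sup>k E\<^sub>1\<^sub>0\<close>, which has dimension \<open>4 \<cdot> 2k\<close>; in general
  it is a super tensor product of \<open>n\<close> such factors. The words \<open>e \<omega>\<^sup>j\<close> with
  \<open>e \<in> {\<psi>, \<psi>\<^sup>*, \<psi>\<psi>\<^sup>*, \<psi>\<^sup>*\<psi>}\<close> and \<open>j < 2k\<close> act as nonzero multiples of \<open>x\<^sup>i E\<^sub>r\<^sub>s\<close>, so their products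
  over the \<open>n\<close> factors are independent. They span because \<open>\<psi>\<psi>\<^sup>*\<psi> = \<omega>\<^sup>k\<psi> = \<omega>\<^sup>-\<^sup>k\<psi>\<close> (and likewise for
  \<open>\<psi>\<^sup>*\<close>) makes \<open>\<omega>\<^sup>2\<^sup>k\<close> act on each of them as a scalar, and \<open>1 = (\<psi>\<psi>\<^sup>* + q\<^sup>k \<psi>\<^sup>*\<psi>) \<omega>\<^sup>k\<close>.\<close>

section \<open>The free algebra\<close>

definition fword :: "gen list \<Rightarrow> ('a::field) falg" where
  "fword u = (\<lambda>w. if w = u then 1 else 0)"

interpretation falg: vector_space "fsmul :: 'a::field \<Rightarrow> 'a falg \<Rightarrow> 'a falg"
  by unfold_locales (simp_all add: fsmul_def fun_eq_iff algebra_simps)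

lemma falg_operations:
  fixes f g :: "('a::field) falg"
  shows "fadd f g = f + g" "fsub f g = f - g" "(fzero :: 'a falg) = 0"
  by (simp_all add: fadd_def fsub_def fzero_def fun_eq_iff)

lemma sum_fun_apply: "(\<Sum>i\<in>A. F i) w = (\<Sum>i\<in>A. F i w)"
  by (induction A rule: infinite_finite_induct) simp_all

lemma fgen_eq_fword: "fgen g = fword [g]"
  by (simp add: fgen_def fword_def)

lemma fone_eq_fword: "fone = fword []"
  by (simp add: fone_def fword_def)

lemma fmul_fword: "fmul (fword u) (fword v) = (fword (u @ v) :: ('a::field) falg)"
proof
  fix w
  have split_iff: "take i w = u \<and> drop i w = v \<longleftrightarrow> i = length u \<and> w = u @ v"
    if "i \<le> length w" for i
    using that append_take_drop_id[of i w] by fastforce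
  have "fmul (fword u) (fword v) w =
      (\<Sum>i\<le>length w. if take i w = u \<and> drop i w = v then 1 else (0::'a))"
    unfolding fmul_def fword_def by (intro sum.cong refl) simp
  also have "\<dots> = (\<Sum>i\<le>length w. if i = length u \<and> w = u @ v then 1 else 0)"
    by (intro sum.cong refl) (simp only: split_iff atMost_iff)
  also have "\<dots> = fword (u @ v) w"
    by (auto simp: fword_def)
  finally show "fmul (fword u) (fword v) w = (fword (u @ v) w :: 'a)" .
qed

lemma fpow_fgen: "fpow (fgen g) m = fword (replicate m g)"
  by (induction m) (simp_all add: fpow_def fone_eq_fword fgen_eq_fword fmul_fword)

interpretation falg_endo: vector_space_pair
  "fsmul :: 'a::field \<Rightarrow> 'a falg \<Rightarrow> 'a falg" "fsmul :: 'a \<Rightarrow> 'a falg \<Rightarrow> 'a falg"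
  by unfold_locales

lemma linear_fmul_left: "Vector_Spaces.linear fsmul fsmul (fmul f)"
  by unfold_locales
    (simp_all add: fmul_def fsmul_def fun_eq_iff algebra_simps sum.distrib sum_distrib_left)

lemma linear_fmul_right: "Vector_Spaces.linear fsmul fsmul (\<lambda>f. fmul f g)"
  by unfold_locales
    (simp_all add: fmul_def fsmul_def fun_eq_iff algebra_simps sum.distrib sum_distrib_left)

lemma subspace_FA: "falg.subspace (FA n)"
proof (rule falg.subspaceI)
  fix f g :: "'a falg" assume fg: "f \<in> FA n" "g \<in> FA n"
  have "{w. (f + g) w \<noteq> 0} \<subseteq> {w. f w \<noteq> 0} \<union> {w. g w \<noteq> 0}"
    by auto
  moreover have "finite ({w. f w \<noteq> 0} \<union> {w. g w \<noteq> 0})"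
    using fg by (simp add: FA_def)
  ultimately show "f + g \<in> FA n"
    using fg finite_subset by (fastforce simp: FA_def)
qed (auto simp: FA_def fsmul_def)

lemma fword_in_FA: "w \<in> lists (Gens n) \<Longrightarrow> fword w \<in> FA n"
  by (auto simp: FA_def fword_def split: if_splits)

lemma FA_eq_span: "FA n = falg.span (fword ` lists (Gens n) :: ('a::field) falg set)"
proof
  show "FA n \<subseteq> falg.span (fword ` lists (Gens n) :: 'a falg set)"
  proof
    fix f :: "'a falg" assume f: "f \<in> FA n"
    then have "f = (\<Sum>w | f w \<noteq> 0. fsmul (f w) (fword w))"
      by (auto simp: fun_eq_iff FA_def sum_fun_apply fsmul_def fword_def if_distrib cong: if_cong)
    also have "\<dots> \<in> falg.span (fword ` lists (Gens n))"
      using f by (intro falg.span_sum falg.span_scale falg.span_base) (auto simp: FA_def)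
    finally show "f \<in> falg.span (fword ` lists (Gens n))" .
  qed
  show "falg.span (fword ` lists (Gens n)) \<subseteq> (FA n :: 'a falg set)"
    by (intro falg.span_minimal subspace_FA) (auto intro: fword_in_FA)
qed

lemma FA_minimal:
  assumes "falg.subspace V" "\<And>w. w \<in> lists (Gens n) \<Longrightarrow> fword w \<in> V"
  shows "FA n \<subseteq> V"
  unfolding FA_eq_span using assms by (intro falg.span_minimal) auto

lemma fmul_in_FA:
  assumes "f \<in> FA n" "g \<in> FA n"
  shows "fmul f g \<in> FA n"
proof -
  have word_word: "fmul (fword u) (fword v) \<in> FA n"
    if "u \<in> lists (Gens n)" "v \<in> lists (Gens n)" for u v
    using that by (simp add: fmul_fword fword_in_FA)
  have "FA n \<subseteq> {g. fmul (fword u) g \<in> FA n}" if "u \<in> lists (Gens n)" for u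
    using that word_word
    by (intro FA_minimal falg_endo.linear_subspace_linear_preimage[OF linear_fmul_left subspace_FA])
       simp
  then have "FA n \<subseteq> {f. fmul f g \<in> FA n}"
    using assms(2)
    by (intro FA_minimal
        falg_endo.linear_subspace_linear_preimage[OF linear_fmul_right subspace_FA]) blast
  then show ?thesis
    using assms(1) by blast
qed

lemma independent_words: "falg.independent (range fword :: ('a::field) falg set)"
  unfolding falg.dependent_def
proof (clarify)
  fix w
  assume "fword w \<in> falg.span (range fword - {fword w} :: 'a falg set)"
  moreover have "falg.span (range fword - {fword w}) \<subseteq> {f :: 'a falg. f w = 0}"
    by (rule falg.span_minimal) (auto simp: fword_def falg.subspace_def fsmul_def)
  ultimately show False
    by (auto simp: fword_def)
qed

interpretation falg_functional: vector_space_pair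
  "fsmul :: 'a::field \<Rightarrow> 'a falg \<Rightarrow> 'a falg" "(*) :: 'a \<Rightarrow> 'a \<Rightarrow> 'a"
  by unfold_locales (simp_all add: algebra_simps)

lemma inj_fword: "inj (fword :: gen list \<Rightarrow> ('a::field) falg)"
  by (rule injI) (metis fword_def zero_neq_one)

text \<open>Beyond the finitely supported functions the values depend on a choice of basis.\<close>

definition word_functional :: "(gen list \<Rightarrow> 'a::field) \<Rightarrow> 'a falg \<Rightarrow> 'a" where
  "word_functional \<phi> = falg_functional.construct (range fword) (\<phi> \<circ> inv fword)"

lemma linear_word_functional: "Vector_Spaces.linear fsmul (*) (word_functional \<phi>)"
  unfolding word_functional_def
  by (rule falg_functional.linear_construct[OF independent_words])

lemma word_functional_fword [simp]: "word_functional \<phi> (fword w) = \<phi> w"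
  by (simp add: word_functional_def falg_functional.construct_basis[OF independent_words] inj_fword)

lemma functional_eq_on_FA:
  assumes "Vector_Spaces.linear fsmul (*) \<phi>" "Vector_Spaces.linear fsmul (*) \<psi>"
    and "\<And>w. w \<in> lists (Gens n) \<Longrightarrow> \<phi> (fword w) = \<psi> (fword w)" and "f \<in> FA n"
  shows "\<phi> f = \<psi> f"
  using assms(4) unfolding FA_eq_span
  by (rule falg_functional.linear_eq_on[OF assms(1,2)]) (use assms(3) in blast)

lemma subspace_ideal_gen: "falg.subspace (ideal_gen n R)"
  using ideal_gen.zero ideal_gen.add ideal_gen.smul
  by (auto simp: falg.subspace_def falg_operations)

lemma ideal_gen_minimal:
  fixes N :: "('a::field) falg set"
  assumes "R \<subseteq> N" "falg.subspace N"
    and left: "\<And>x u. x \<in> N \<Longrightarrow> u \<in> lists (Gens n) \<Longrightarrow> fmul (fword u) x \<in> N"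
    and right: "\<And>x u. x \<in> N \<Longrightarrow> u \<in> lists (Gens n) \<Longrightarrow> fmul x (fword u) \<in> N"
  shows "ideal_gen n R \<subseteq> N"
proof
  fix x assume "x \<in> ideal_gen n R"
  then show "x \<in> N"
  proof induction
    case (lmul x f)
    have "FA n \<subseteq> {f. fmul f x \<in> N}"
      using left[OF lmul.IH]
      by (intro FA_minimal falg_endo.linear_subspace_linear_preimage[OF linear_fmul_right assms(2)])
         simp
    then show ?case
      using lmul.hyps(2) by blast
  next
    case (rmul x f)
    have "FA n \<subseteq> {f. fmul x f \<in> N}"
      using right[OF rmul.IH]
      by (intro FA_minimal falg_endo.linear_subspace_linear_preimage[OF linear_fmul_left assms(2)])
         simp
    then show ?case
      using rmul.hyps(2) by blast
  qed (use assms(1,2) in \<open>auto simp: falg.subspace_def simp flip: falg_operations\<close>)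
qed

lemma inj_on_if_independent_modulo:
  fixes x :: "'i \<Rightarrow> ('a::field) falg"
  assumes "0 \<in> I" "finite X"
    and independent: "\<And>c i. (\<Sum>i\<in>X. fsmul (c i) (x i)) \<in> I \<Longrightarrow> i \<in> X \<Longrightarrow> c i = 0"
  shows "inj_on x X"
proof (rule inj_onI, rule ccontr)
  fix i j assume ij: "i \<in> X" "j \<in> X" "x i = x j" "i \<noteq> j"
  define c where "c l = (if l = i then 1 else if l = j then - 1 else (0::'a))" for l
  have "(\<Sum>l\<in>X. fsmul (c l) (x l)) = (\<Sum>l\<in>{i, j}. fsmul (c l) (x l))"
    using assms(2) ij by (intro sum.mono_neutral_right) (auto simp: c_def)
  also have "\<dots> = 0"
    using ij by (simp add: c_def)
  finally show False
    using independent[of c i] ij assms(1) by (simp add: c_def)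
qed

lemma quotient_dim_eqI:
  fixes x :: "'i \<Rightarrow> ('a::field) falg"
  assumes "falg.subspace I" "finite X" "x ` X \<subseteq> FA n"
    and independent: "\<And>c i. (\<Sum>i\<in>X. fsmul (c i) (x i)) \<in> I \<Longrightarrow> i \<in> X \<Longrightarrow> c i = 0"
    and spanning: "FA n \<subseteq> falg.span (I \<union> x ` X)"
  shows "quotient_dim_eq n I (card X)"
  unfolding quotient_dim_eq_def
proof (intro exI[of _ "x ` X"] conjI)
  have inj: "inj_on x X"
    using falg.subspace_0[OF assms(1)] assms(2) independent by (rule inj_on_if_independent_modulo)
  have combination: "(\<lambda>w. \<Sum>b\<in>x ` X. c b * b w) = (\<Sum>b\<in>x ` X. fsmul (c b) b)" for c
    by (simp add: fun_eq_iff sum_fun_apply fsmul_def)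
  show "card (x ` X) = card X"
    by (rule card_image[OF inj])
  show "\<forall>c. (\<lambda>w. \<Sum>b\<in>x ` X. c b * b w) \<in> I \<longrightarrow> (\<forall>b\<in>x ` X. c b = 0)"
    unfolding combination using independent[of "\<lambda>i. c (x i)" for c]
    by (simp add: sum.reindex[OF inj])
  show "\<forall>f\<in>FA n. \<exists>c. fsub f (\<lambda>w. \<Sum>b\<in>x ` X. c b * b w) \<in> I"
  proof
    fix f :: "'a falg" assume "f \<in> FA n"
    then have "f \<in> falg.span (I \<union> x ` X)"
      using spanning by blast
    then obtain y c where "y \<in> I" "f = y + (\<Sum>b\<in>x ` X. fsmul (c b) b)"
      using assms(1,2) by (auto simp: falg.span_Un falg.span_finite falg.span_eq_iff[THEN iffD2])
    then show "\<exists>c. fsub f (\<lambda>w. \<Sum>b\<in>x ` X. c b * b w) \<in> I"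
      by (auto simp: combination falg_operations intro!: exI[of _ c])
  qed
qed (use assms in auto)

section \<open>Reduction of words modulo relations\<close>

locale presentation =
  fixes n :: nat and R :: "('a::field) falg set"
begin

abbreviation ideal :: "'a falg set" where
  "ideal \<equiv> ideal_gen n R"

text \<open>Scalars are forgotten. Words with letters outside \<open>Gens n\<close> reduce to everything, so that the
  rules below need no side conditions on the surrounding words.\<close>

definition reduces :: "gen list \<Rightarrow> gen list set \<Rightarrow> bool" (infix "\<leadsto>" 50) where
  "x \<leadsto> Y \<longleftrightarrow> (x \<in> lists (Gens n) \<longrightarrow>
    fword x \<in> falg.span (ideal \<union> fword ` (Y \<inter> lists (Gens n))))"

lemma reduces_refl: "x \<in> Y \<Longrightarrow> x \<leadsto> Y"
  unfolding reduces_def by (blast intro: falg.span_base)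

lemma reduces_context:
  assumes "x \<leadsto> Y" and Y: "\<And>y. y \<in> Y \<Longrightarrow> u @ y @ v \<leadsto> Z"
  shows "u @ x @ v \<leadsto> Z"
  unfolding reduces_def
proof
  assume uxv: "u @ x @ v \<in> lists (Gens n)"
  let ?Z = "falg.span (ideal \<union> fword ` (Z \<inter> lists (Gens n)))"
  let ?L = "\<lambda>f. fmul (fword u) (fmul f (fword v))"
  have "Vector_Spaces.linear fsmul fsmul ?L"
    using Vector_Spaces.linear_compose[OF linear_fmul_right linear_fmul_left]
    by (simp add: comp_def)
  then have subspace: "falg.subspace {f. ?L f \<in> ?Z}"
    by (rule falg_endo.linear_subspace_linear_preimage[OF _ falg.subspace_span])
  have "?L f \<in> ?Z" if "f \<in> ideal" for f
  proof -
    have "?L f \<in> ideal"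
      using that uxv by (auto intro!: ideal_gen.lmul[OF ideal_gen.rmul] fword_in_FA)
    then show ?thesis
      by (simp add: falg.span_base)
  qed
  moreover have "?L (fword y) \<in> ?Z" if "y \<in> Y" "y \<in> lists (Gens n)" for y
    using Y[OF that(1)] that(2) uxv by (simp add: reduces_def fmul_fword)
  ultimately have "falg.span (ideal \<union> fword ` (Y \<inter> lists (Gens n))) \<subseteq> {f. ?L f \<in> ?Z}"
    by (intro falg.span_minimal subspace) blast
  moreover have "fword x \<in> falg.span (ideal \<union> fword ` (Y \<inter> lists (Gens n)))"
    using assms(1) uxv by (simp add: reduces_def)
  ultimately show "fword (u @ x @ v) \<in> ?Z"
    by (auto simp: fmul_fword)
qed

lemma reduces_trans: "x \<leadsto> Y \<Longrightarrow> (\<And>y. y \<in> Y \<Longrightarrow> y \<leadsto> Z) \<Longrightarrow> x \<leadsto> Z"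
  using reduces_context[of x Y "[]" "[]" Z] by simp

lemma reduces_by_relation:
  assumes "fsmul c (fword x) - f \<in> ideal" "c \<noteq> 0"
    and "f \<in> falg.span (fword ` (Y \<inter> lists (Gens n)))"
  shows "x \<leadsto> Y"
  unfolding reduces_def
proof
  let ?Y = "falg.span (ideal \<union> fword ` (Y \<inter> lists (Gens n)))"
  have "fsmul c (fword x) - f \<in> ?Y" "f \<in> ?Y"
    using assms(1) falg.span_mono[of "fword ` (Y \<inter> lists (Gens n))"] assms(3)
    by (auto intro: falg.span_base)
  then have "fsmul (inverse c) (fsmul c (fword x) - f + f) \<in> ?Y"
    by (intro falg.span_scale falg.span_add)
  then show "fword x \<in> ?Y"
    using assms(2) by simp
qed

definition proportional :: "gen list \<Rightarrow> gen list \<Rightarrow> bool" (infix "\<approx>" 50) where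
  "x \<approx> y \<longleftrightarrow> x \<leadsto> {y} \<and> y \<leadsto> {x}"

lemma proportional_refl [simp]: "x \<approx> x"
  by (simp add: proportional_def reduces_refl)

lemma proportional_sym: "x \<approx> y \<Longrightarrow> y \<approx> x"
  by (simp add: proportional_def)

lemma proportional_trans [trans]: "x \<approx> y \<Longrightarrow> y \<approx> z \<Longrightarrow> x \<approx> z"
  unfolding proportional_def by (blast intro: reduces_trans)

lemma proportional_reduces [trans]: "x \<approx> y \<Longrightarrow> y \<leadsto> Z \<Longrightarrow> x \<leadsto> Z"
  unfolding proportional_def by (blast intro: reduces_trans)

lemma proportional_context: "x \<approx> y \<Longrightarrow> u @ x @ v \<approx> u @ y @ v"
  unfolding proportional_def by (auto intro: reduces_refl reduces_context)

lemma proportionalI: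
  assumes "fword x - fsmul c (fword y) \<in> ideal" "c \<noteq> 0"
    and "x \<in> lists (Gens n)" "y \<in> lists (Gens n)"
  shows "x \<approx> y"
proof -
  have words: "fword x \<in> falg.span (fword ` ({x} \<inter> lists (Gens n)))"
    "fsmul c (fword y) \<in> falg.span (fword ` ({y} \<inter> lists (Gens n)))"
    using assms(3,4) by (simp_all add: falg.span_base falg.span_scale)
  have "x \<leadsto> {y}"
    using assms(1) words(2) by (intro reduces_by_relation[of 1]) simp_all
  moreover have "y \<leadsto> {x}"
    using falg.subspace_neg[OF subspace_ideal_gen assms(1)] assms(2) words(1)
    by (intro reduces_by_relation[of c]) simp_all
  ultimately show ?thesis
    by (simp add: proportional_def)
qed

lemma proportional_commute_letter:
  assumes "\<And>h. h \<in> set y \<Longrightarrow> [g, h] \<approx> [h, g]"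
  shows "g # y \<approx> y @ [g]"
  using assms
proof (induction y)
  case (Cons h y)
  have "g # h # y \<approx> h # g # y"
    using proportional_context[of "[g, h]" "[h, g]" "[]" y] Cons.prems by simp
  also have "\<dots> \<approx> h # y @ [g]"
    using proportional_context[OF Cons.IH, of "[h]" "[]"] Cons.prems by simp
  finally show ?case by simp
qed simp

lemma proportional_commute:
  assumes "\<And>g h. g \<in> set x \<Longrightarrow> h \<in> set y \<Longrightarrow> [g, h] \<approx> [h, g]"
  shows "x @ y \<approx> y @ x"
  using assms
proof (induction x)
  case (Cons g x)
  have "g # x @ y \<approx> g # y @ x"
    using proportional_context[OF Cons.IH, of "[g]" "[]"] Cons.prems by simp
  also have "\<dots> \<approx> y @ g # x"
    using proportional_context[OF proportional_commute_letter, of y g "[]" x] Cons.prems by simp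
  finally show ?case by simp
qed simp

lemma proportional_inverse_commute:
  assumes "u @ v \<approx> []" "v @ u \<approx> []" "u @ x \<approx> x @ u"
  shows "v @ x \<approx> x @ v"
proof -
  have "v @ x \<approx> v @ x @ u @ v"
    using proportional_context[OF proportional_sym[OF assms(1)], of "v @ x" "[]"] by simp
  also have "\<dots> \<approx> v @ u @ x @ v"
    using proportional_context[OF proportional_sym[OF assms(3)], of v v] by simp
  also have "\<dots> \<approx> x @ v"
    using proportional_context[OF assms(2), of "[]" "x @ v"] by simp
  finally show ?thesis .
qed

lemma proportional_replicate_cancel:
  assumes "[g, h] \<approx> []"
  shows "replicate j g @ replicate j h \<approx> []"
proof (induction j)
  case (Suc j)
  have "replicate j g @ [g, h] @ replicate j h \<approx> replicate j g @ [] @ replicate j h"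
    by (rule proportional_context[OF assms])
  also have "replicate j g @ [] @ replicate j h \<approx> []"
    using Suc by simp
  finally show ?case
    by (simp add: replicate_app_Cons_same)
qed simp

end

section \<open>A monomial representation\<close>

lemma Cl_rels_words:
  "Cl_rels q n k = (\<Union>a\<in>{1..n}. \<Union>b\<in>{1..n}.
    { fword [Om a, Om b] - fword [Om b, Om a],
      fword [Om a, OmI a] - fword [],
      fword [OmI a, Om a] - fword [],
      fword [Om a, Psi b] - fsmul (q ^ (if a = b then 1 else 0)) (fword [Psi b, Om a]),
      fword [Om a, PsiS b] - fsmul (inverse q ^ (if a = b then 1 else 0)) (fword [PsiS b, Om a]),
      fword [Psi a, Psi b] + fword [Psi b, Psi a],
      fword [PsiS a, PsiS b] + fword [PsiS b, PsiS a],
      fword [Psi a, PsiS a] + fsmul (q ^ k) (fword [PsiS a, Psi a])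
        - fword (replicate k (OmI a)),
      fword [Psi a, PsiS a] + fsmul (inverse q ^ k) (fword [PsiS a, Psi a])
        - fword (replicate k (Om a)) }
    \<union> (if a \<noteq> b then { fword [Psi a, PsiS b] + fword [PsiS b, Psi a] } else {}))"
  unfolding Cl_rels_def Let_def fpow_fgen falg_operations
  by (simp only: fgen_eq_fword fone_eq_fword fmul_fword append.simps)

text \<open>Functions on states \<open>(S, m)\<close> form the representation space: \<open>S\<close> selects a coordinate of \<open>F\<^sup>2\<close>
  in each tensor factor, and \<open>x\<close> acts on the \<open>a\<close>-th factor by shifting \<open>m a \<in> \<int>/2k\<close>, whose elements
  are represented by their remainders.\<close>

type_synonym state = "nat set \<times> (nat \<Rightarrow> int)"

definition shift :: "nat \<Rightarrow> nat \<Rightarrow> int \<Rightarrow> (nat \<Rightarrow> int) \<Rightarrow> nat \<Rightarrow> int" where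
  "shift k a i m = m(a := (m a + i) mod (2 * int k))"

definition reduced :: "nat \<Rightarrow> (nat \<Rightarrow> int) \<Rightarrow> bool" where
  "reduced k m \<longleftrightarrow> (\<forall>a. m a mod (2 * int k) = m a)"

definition jordan_wigner :: "nat \<Rightarrow> nat set \<Rightarrow> 'a::field" where
  "jordan_wigner a S = (-1) ^ card {b\<in>S. b < a}"

fun move :: "nat \<Rightarrow> gen \<Rightarrow> state \<Rightarrow> state" where
  "move k (Psi a) (S, m) = (insert a S, m)"
| "move k (PsiS a) (S, m) = (S - {a}, shift k a (int k) m)"
| "move k (Om a) (S, m) = (S, shift k a 1 m)"
| "move k (OmI a) (S, m) = (S, shift k a (- 1) m)"

fun weight :: "'a::field \<Rightarrow> gen \<Rightarrow> state \<Rightarrow> 'a" where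
  "weight q (Psi a) (S, m) = (if a \<in> S then 0 else jordan_wigner a S)"
| "weight q (PsiS a) (S, m) = (if a \<in> S then jordan_wigner a S else 0)"
| "weight q (Om a) (S, m) = (if a \<in> S then inverse q else 1)"
| "weight q (OmI a) (S, m) = (if a \<in> S then q else 1)"

abbreviation moves :: "nat \<Rightarrow> gen list \<Rightarrow> state \<Rightarrow> state" where
  "moves k \<equiv> fold (move k)"

fun word_weight :: "'a::field \<Rightarrow> nat \<Rightarrow> gen list \<Rightarrow> state \<Rightarrow> 'a" where
  "word_weight q k [] \<sigma> = 1"
| "word_weight q k (g # w) \<sigma> = weight q g \<sigma> * word_weight q k w (move k g \<sigma>)"

definition act :: "'a::field \<Rightarrow> nat \<Rightarrow> gen list \<Rightarrow> (state \<Rightarrow> 'a) \<Rightarrow> state \<Rightarrow> 'a" where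
  "act q k w h \<sigma> = word_weight q k w \<sigma> * h (moves k w \<sigma>)"

definition matrix_coeff :: "'a::field \<Rightarrow> nat \<Rightarrow> (state \<Rightarrow> 'a) \<Rightarrow> state \<Rightarrow> 'a falg \<Rightarrow> 'a" where
  "matrix_coeff q k h \<sigma> = word_functional (\<lambda>w. act q k w h \<sigma>)"

lemma matrix_coeff_fword [simp]: "matrix_coeff q k h \<sigma> (fword w) = act q k w h \<sigma>"
  by (simp add: matrix_coeff_def)

lemma linear_matrix_coeff: "Vector_Spaces.linear fsmul (*) (matrix_coeff q k h \<sigma>)"
  unfolding matrix_coeff_def by (rule linear_word_functional)

lemma word_weight_append:
  "word_weight q k (u @ v) \<sigma> = word_weight q k u \<sigma> * word_weight q k v (moves k u \<sigma>)"
  by (induction u arbitrary: \<sigma>) simp_all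

lemma act_Nil [simp]: "act q k [] h \<sigma> = h \<sigma>"
  by (simp add: act_def)

lemma act_append: "act q k (u @ v) h = act q k u (act q k v h)"
  by (rule ext) (simp only: act_def word_weight_append fold_append o_apply mult.assoc)

lemma matrix_coeff_fword_fmul:
  assumes "f \<in> FA n"
  shows "matrix_coeff q k h \<sigma> (fmul (fword u) f) =
    word_weight q k u \<sigma> * matrix_coeff q k h (moves k u \<sigma>) f"
proof (rule functional_eq_on_FA[OF _ _ _ assms])
  show "Vector_Spaces.linear fsmul (*) (\<lambda>f. matrix_coeff q k h \<sigma> (fmul (fword u) f))"
    using Vector_Spaces.linear_compose[OF linear_fmul_left linear_matrix_coeff]
    by (simp add: comp_def)
  show "Vector_Spaces.linear fsmul (*)
      (\<lambda>f. word_weight q k u \<sigma> * matrix_coeff q k h (moves k u \<sigma>) f)"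
    by (rule falg_functional.linear_compose_scale_right[OF linear_matrix_coeff])
qed (simp add: fmul_fword act_def word_weight_append)

lemma matrix_coeff_fmul_fword:
  assumes "f \<in> FA n"
  shows "matrix_coeff q k h \<sigma> (fmul f (fword u)) = matrix_coeff q k (act q k u h) \<sigma> f"
proof (rule functional_eq_on_FA[OF _ linear_matrix_coeff _ assms])
  show "Vector_Spaces.linear fsmul (*) (\<lambda>f. matrix_coeff q k h \<sigma> (fmul f (fword u)))"
    using Vector_Spaces.linear_compose[OF linear_fmul_right linear_matrix_coeff]
    by (simp add: comp_def)
qed (simp add: fmul_fword act_append)

lemma jordan_wigner_square [simp]: "jordan_wigner a S * jordan_wigner a S = 1"
  by (simp add: jordan_wigner_def flip: power_mult_distrib)

lemma jordan_wigner_square_assoc [simp]: "jordan_wigner a S * (jordan_wigner a S * x) = x"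
  by (simp flip: mult.assoc)

lemma jordan_wigner_nonzero [simp]: "jordan_wigner a S \<noteq> 0"
  by (simp add: jordan_wigner_def)

lemma jordan_wigner_insert:
  "jordan_wigner a (insert b S) =
    (if b < a \<and> b \<notin> S then - jordan_wigner a S else jordan_wigner a S)"
proof -
  have "{c \<in> insert b S. c < a} = (if b < a then insert b {c\<in>S. c < a} else {c\<in>S. c < a})"
    by auto
  then show ?thesis
    by (auto simp: jordan_wigner_def card_insert_if)
qed

lemma jordan_wigner_remove:
  "(jordan_wigner a (S - {b}) :: 'a::field) =
    (if b < a \<and> b \<in> S then - jordan_wigner a S else jordan_wigner a S)"
proof (cases "b \<in> S")
  case True
  then show ?thesis
    using jordan_wigner_insert[of a b "S - {b}", where 'a = 'a] by (auto simp: insert_absorb)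
qed simp

lemma shift_shift: "shift k a i (shift k a j m) = shift k a (i + j) m"
  by (simp add: shift_def mod_simps algebra_simps)

lemma shift_commute: "shift k a i (shift k b j m) = shift k b j (shift k a i m)"
  by (cases "a = b") (simp_all add: shift_shift add.commute, simp add: shift_def fun_upd_twist)

lemma shift_zero: "reduced k m \<Longrightarrow> shift k a 0 m = m"
  by (simp add: shift_def reduced_def)

lemma shift_minus_half: "shift k a (- int k) m = shift k a (int k) m"
proof -
  have "(m a + (- int k)) mod (2 * int k) = (m a + int k) mod (2 * int k)"
    by (simp add: mod_eq_dvd_iff)
  then show ?thesis by (simp only: shift_def)
qed

lemma reduced_shift: "reduced k m \<Longrightarrow> reduced k (shift k a i m)"
  by (simp add: reduced_def shift_def)

lemma reduced_moves: "reduced k (snd \<sigma>) \<Longrightarrow> reduced k (snd (moves k w \<sigma>))"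
proof (induction w arbitrary: \<sigma>)
  case (Cons g w)
  then have "reduced k (snd (move k g \<sigma>))"
    by (cases \<sigma>; cases g) (simp_all add: reduced_shift)
  then show ?case
    using Cons.IH by simp
qed simp

lemma funpow_move_Om:
  "reduced k m \<Longrightarrow> (move k (Om a) ^^ j) (S, m) = (S, shift k a (int j) m)"
  by (induction j) (simp_all add: shift_zero shift_shift)

lemma funpow_move_OmI:
  "reduced k m \<Longrightarrow> (move k (OmI a) ^^ j) (S, m) = (S, shift k a (- int j) m)"
  by (induction j) (simp_all add: shift_zero shift_shift)

lemma word_weight_replicate_Om:
  "word_weight q k (replicate j (Om a)) (S, m) = (if a \<in> S then inverse q else 1) ^ j"
  by (induction j arbitrary: m) simp_all

lemma word_weight_replicate_OmI:
  "word_weight q k (replicate j (OmI a)) (S, m) = (if a \<in> S then q else 1) ^ j"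
  by (induction j arbitrary: m) simp_all

lemma act_Om_Om: "act q k [Om a, Om b] h \<sigma> = act q k [Om b, Om a] h \<sigma>"
  by (cases \<sigma>) (simp add: act_def shift_commute)

lemma act_Om_OmI:
  assumes "q \<noteq> 0" "reduced k (snd \<sigma>)"
  shows "act q k [Om a, OmI a] h \<sigma> = h \<sigma>" "act q k [OmI a, Om a] h \<sigma> = h \<sigma>"
  using assms by (cases \<sigma>; simp add: act_def shift_shift shift_zero)+

lemma act_Om_Psi:
  "q \<noteq> 0 \<Longrightarrow> act q k [Om a, Psi b] h \<sigma> = q ^ (if a = b then 1 else 0) * act q k [Psi b, Om a] h \<sigma>"
  by (cases \<sigma>) (simp add: act_def)

lemma act_Om_PsiS:
  "act q k [Om a, PsiS b] h \<sigma> = inverse q ^ (if a = b then 1 else 0) * act q k [PsiS b, Om a] h \<sigma>"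
  by (cases \<sigma>) (simp add: act_def shift_commute)

lemma act_Psi_Psi: "act q k [Psi a, Psi b] h \<sigma> + act q k [Psi b, Psi a] h \<sigma> = 0"
  by (cases \<sigma>; cases a b rule: linorder_cases)
     (simp_all add: act_def jordan_wigner_insert insert_commute)

lemma act_PsiS_PsiS: "act q k [PsiS a, PsiS b] h \<sigma> + act q k [PsiS b, PsiS a] h \<sigma> = 0"
proof (cases \<sigma>)
  case (Pair S m)
  have "S - {a} - {b} = S - {b} - {a}" by blast
  then show ?thesis
    by (cases a b rule: linorder_cases)
       (simp_all add: Pair act_def jordan_wigner_remove shift_commute)
qed

lemma act_Psi_PsiS_distinct:
  assumes "a \<noteq> b"
  shows "act q k [Psi a, PsiS b] h \<sigma> + act q k [PsiS b, Psi a] h \<sigma> = 0"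
proof (cases \<sigma>)
  case (Pair S m)
  have "insert a S - {b} = insert a (S - {b})" using assms by blast
  then show ?thesis
    using assms
    by (cases a b rule: linorder_cases)
       (simp_all add: Pair act_def jordan_wigner_insert jordan_wigner_remove)
qed

lemma act_Psi_PsiS_same:
  assumes "reduced k (snd \<sigma>)"
  shows "act q k [Psi a, PsiS a] h \<sigma> + q ^ k * act q k [PsiS a, Psi a] h \<sigma>
      = act q k (replicate k (OmI a)) h \<sigma>"
    and "act q k [Psi a, PsiS a] h \<sigma> + inverse q ^ k * act q k [PsiS a, Psi a] h \<sigma>
      = act q k (replicate k (Om a)) h \<sigma>"
proof -
  obtain S m where \<sigma>: "\<sigma> = (S, m)" by fastforce
  note simps = act_def jordan_wigner_insert jordan_wigner_remove insert_absorb shift_minus_half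
    funpow_move_Om funpow_move_OmI word_weight_replicate_Om word_weight_replicate_OmI
  show "act q k [Psi a, PsiS a] h \<sigma> + q ^ k * act q k [PsiS a, Psi a] h \<sigma>
      = act q k (replicate k (OmI a)) h \<sigma>"
    using assms by (cases "a \<in> S") (simp_all add: \<sigma> simps)
  show "act q k [Psi a, PsiS a] h \<sigma> + inverse q ^ k * act q k [PsiS a, Psi a] h \<sigma>
      = act q k (replicate k (Om a)) h \<sigma>"
    using assms by (cases "a \<in> S") (simp_all add: \<sigma> simps)
qed

lemma matrix_coeff_Cl_rels:
  assumes "r \<in> Cl_rels q n k" "q \<noteq> 0" "reduced k (snd \<sigma>)"
  shows "matrix_coeff q k h \<sigma> r = 0"
proof -
  interpret coeff: Vector_Spaces.linear fsmul "(*)" "matrix_coeff q k h \<sigma>"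
    by (rule linear_matrix_coeff)
  note [simp] = coeff.add coeff.diff coeff.scale
  show ?thesis
    using assms(1) unfolding Cl_rels_words
    by (elim UN_E UnE insertE emptyE)
       (simp_all add: act_Om_Om act_Om_OmI[OF assms(2,3)]
          act_Om_Psi[OF assms(2)] act_Om_PsiS act_Psi_Psi act_PsiS_PsiS act_Psi_PsiS_distinct
          act_Psi_PsiS_same[OF assms(3)] split: if_splits)
qed

lemma subspace_Cl_ideal: "falg.subspace (Cl_ideal q n k)"
  unfolding Cl_ideal_def by (rule subspace_ideal_gen)

lemma Cl_rels_subset_FA: "Cl_rels q n k \<subseteq> FA n"
proof -
  note [intro!] = falg.subspace_add[OF subspace_FA] falg.subspace_diff[OF subspace_FA]
    falg.subspace_scale[OF subspace_FA] fword_in_FA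
  show ?thesis
    unfolding Cl_rels_words by (auto simp: Gens_def split: if_splits)
qed

lemma matrix_coeff_Cl_ideal:
  assumes "x \<in> Cl_ideal q n k" "q \<noteq> 0" "reduced k (snd \<sigma>)"
  shows "matrix_coeff q k h \<sigma> x = 0"
proof -
  define annihilator where "annihilator =
    {f \<in> FA n. \<forall>h \<sigma>. reduced k (snd \<sigma>) \<longrightarrow> matrix_coeff q k h \<sigma> f = 0}"
  have "annihilator = FA n \<inter> (\<Inter>h. \<Inter>\<sigma>\<in>{\<sigma>. reduced k (snd \<sigma>)}. {f. matrix_coeff q k h \<sigma> f = 0})"
    by (auto simp: annihilator_def)
  moreover have "falg.subspace {f. matrix_coeff q k h \<sigma> f = 0}" for h \<sigma>
    by (rule falg_functional.linear_subspace_kernel[OF linear_matrix_coeff])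
  ultimately have "falg.subspace annihilator"
    by (auto simp: FA_eq_span intro!: falg.subspace_inter falg.subspace_Inter)
  then have "Cl_ideal q n k \<subseteq> annihilator"
    unfolding Cl_ideal_def
  proof (rule ideal_gen_minimal[rotated])
    show "Cl_rels q n k \<subseteq> annihilator"
      using Cl_rels_subset_FA matrix_coeff_Cl_rels assms(2) by (fastforce simp: annihilator_def)
  next
    fix x u assume x: "x \<in> annihilator" and "u \<in> lists (Gens n)"
    moreover from x have "x \<in> FA n"
      by (simp add: annihilator_def)
    ultimately show "fmul (fword u) x \<in> annihilator" "fmul x (fword u) \<in> annihilator"
      unfolding annihilator_def
      by (simp_all add: fmul_in_FA fword_in_FA matrix_coeff_fword_fmul[of x n]
          matrix_coeff_fmul_fword[of x n] reduced_moves del: split_paired_All in_lists_conv_set)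
  qed
  then show ?thesis
    using assms(1,3) unfolding annihilator_def by blast
qed

section \<open>Normal words\<close>

text \<open>In the representation above \<open>ladder a s\<close> is a monomial multiple of the matrix unit \<open>E s (\<not> s)\<close>
  in the \<open>a\<close>-th tensor factor, and \<open>unit_word a s t\<close> one of \<open>E s t\<close>.\<close>

definition ladder :: "nat \<Rightarrow> bool \<Rightarrow> gen" where
  "ladder a s = (if s then PsiS a else Psi a)"

lemma gen_idx_ladder [simp]: "gen_idx (ladder a s) = a"
  by (simp add: ladder_def)

lemma gen_cases:
  obtains (ladder) a s where "g = ladder a s" | (Om) a where "g = Om a" | (OmI) a where "g = OmI a"
proof (cases g)
  case (Psi a)
  then show ?thesis using ladder[of a False] by (simp add: ladder_def)
next
  case (PsiS a)
  then show ?thesis using ladder[of a True] by (simp add: ladder_def)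
qed (use Om OmI in auto)

definition unit_word :: "nat \<Rightarrow> bool \<Rightarrow> bool \<Rightarrow> gen list" where
  "unit_word a s t = ladder a s # (if s = t then [ladder a (\<not> s)] else [])"

type_synonym block_index = "bool \<times> bool \<times> nat"

fun block :: "nat \<Rightarrow> block_index \<Rightarrow> gen list" where
  "block a (s, t, j) = unit_word a s t @ replicate j (Om a)"

definition block_indices :: "nat \<Rightarrow> block_index set" where
  "block_indices k = UNIV \<times> UNIV \<times> {..<2 * k}"

definition blocks :: "nat \<Rightarrow> nat \<Rightarrow> gen list set" where
  "blocks k a = block a ` block_indices k"

definition normal_word :: "nat \<Rightarrow> (nat \<Rightarrow> block_index) \<Rightarrow> gen list" where
  "normal_word n I = concat (map (\<lambda>a. block a (I a)) [1..<Suc n])"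

definition normal_indices :: "nat \<Rightarrow> nat \<Rightarrow> (nat \<Rightarrow> block_index) set" where
  "normal_indices k n = {1..n} \<rightarrow>\<^sub>E block_indices k"

lemma finite_normal_indices: "finite (normal_indices k n)"
  by (simp add: normal_indices_def block_indices_def finite_PiE)

lemma card_normal_indices: "card (normal_indices k n) = (8 * k) ^ n"
  by (simp add: normal_indices_def block_indices_def card_PiE card_cartesian_product)

lemma normal_word_0 [simp]: "normal_word 0 I = []"
  by (simp add: normal_word_def)

lemma normal_word_Suc [simp]: "normal_word (Suc n) I = normal_word n I @ block (Suc n) (I (Suc n))"
  by (simp add: normal_word_def)

lemma normal_word_cong: "(\<And>a. a \<in> {1..n} \<Longrightarrow> I a = J a) \<Longrightarrow> normal_word n I = normal_word n J"
  by (induction n) auto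

lemma set_block: "set (block a i) \<subseteq> {Psi a, PsiS a, Om a}"
  by (cases i) (auto simp: unit_word_def ladder_def)

lemma normal_word_in_lists_Gens: "normal_word n I \<in> lists (Gens n)"
proof (rule in_listsI, rule ballI)
  fix g assume "g \<in> set (normal_word n I)"
  then obtain a where "a \<in> {1..n}" "g \<in> set (block a (I a))"
    by (auto simp: normal_word_def less_Suc_eq_le simp del: upt_Suc)
  then show "g \<in> Gens n"
    using set_block[of a "I a"] by (auto simp: Gens_def)
qed

definition normal_words :: "nat \<Rightarrow> nat \<Rightarrow> gen list set" where
  "normal_words k n = normal_word n ` normal_indices k n"

lemma normal_words_0: "normal_words k 0 = {[]}"
  by (simp add: normal_words_def normal_indices_def)

lemma normal_words_Suc:
  "normal_words k (Suc n) = {x @ y | x y. x \<in> normal_words k n \<and> y \<in> blocks k (Suc n)}"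
proof -
  have extend: "normal_word (Suc n) (I(Suc n := i)) = normal_word n I @ block (Suc n) i" for I i
    using normal_word_cong[of n "I(Suc n := i)" I] by simp
  have "{1..Suc n} = insert (Suc n) {1..n}"
    by auto
  then have "normal_indices k (Suc n) =
      (\<lambda>(i, I). I(Suc n := i)) ` (block_indices k \<times> normal_indices k n)"
    unfolding normal_indices_def by (simp only: PiE_insert_eq)
  then have "normal_words k (Suc n) =
      (\<lambda>(i, I). normal_word n I @ block (Suc n) i) ` (block_indices k \<times> normal_indices k n)"
    by (simp add: normal_words_def image_image case_prod_unfold extend del: normal_word_Suc)
  also have "\<dots> = {x @ y | x y. x \<in> normal_words k n \<and> y \<in> blocks k (Suc n)}"
    by (auto simp: normal_words_def blocks_def image_iff simp del: block.simps)
  finally show ?thesis .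
qed

subsection \<open>Independence\<close>

abbreviation row :: "block_index \<Rightarrow> bool" where
  "row i \<equiv> fst i"

abbreviation col :: "block_index \<Rightarrow> bool" where
  "col i \<equiv> fst (snd i)"

fun block_shift :: "nat \<Rightarrow> block_index \<Rightarrow> int" where
  "block_shift k (s, t, j) = int j + (if s \<or> \<not> t then int k else 0)"

lemma moves_block:
  assumes "reduced k m"
  shows "moves k (block a i) (S, m) =
    (if col i then insert a S else S - {a}, shift k a (block_shift k i) m)"
  using assms
  by (cases i)
     (simp add: unit_word_def ladder_def funpow_move_Om reduced_shift shift_shift add.commute)

lemma word_weight_block_nonzero:
  "q \<noteq> 0 \<Longrightarrow> word_weight q k (block a i) (S, m) \<noteq> 0 \<longleftrightarrow> (a \<in> S \<longleftrightarrow> row i)"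
  by (cases i) (simp add: unit_word_def ladder_def word_weight_append word_weight_replicate_Om)

lemma moves_normal_word:
  assumes "reduced k m"
  shows "moves k (normal_word n I) (S, m) =
    ({a. if a \<in> {1..n} then col (I a) else a \<in> S},
     \<lambda>a. if a \<in> {1..n} then (m a + block_shift k (I a)) mod (2 * int k) else m a)"
proof (induction n)
  case (Suc n)
  let ?m = "\<lambda>a. if a \<in> {1..n} then (m a + block_shift k (I a)) mod (2 * int k) else m a"
  have "reduced k ?m"
    using assms by (simp add: reduced_def)
  then show ?case
    by (auto simp: Suc moves_block shift_def le_Suc_eq fun_eq_iff)
qed simp

lemma word_weight_normal_word_nonzero:
  assumes "q \<noteq> 0" "reduced k m"
  shows "word_weight q k (normal_word n I) (S, m) \<noteq> 0 \<longleftrightarrow> (\<forall>a\<in>{1..n}. a \<in> S \<longleftrightarrow> row (I a))"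
proof (induction n)
  case (Suc n)
  then show ?case
    using assms
    by (auto simp: word_weight_append moves_normal_word word_weight_block_nonzero
        atLeastAtMostSuc_conv)
qed simp

definition source :: "nat \<Rightarrow> (nat \<Rightarrow> block_index) \<Rightarrow> state" where
  "source n I = ({a\<in>{1..n}. row (I a)}, \<lambda>_. 0)"

lemma reduced_source: "reduced k (snd (source n I))"
  by (simp add: source_def reduced_def)

lemma block_index_eqI:
  assumes "i \<in> block_indices k" "j \<in> block_indices k" "row i = row j" "col i = col j"
    and "block_shift k i mod (2 * int k) = block_shift k j mod (2 * int k)"
  shows "i = j"
proof -
  obtain s t l l' where i: "i = (s, t, l)" and j: "j = (s, t, l')"
    using assms(3,4) by (cases i; cases j) simp
  have "int l mod (2 * int k) = int l' mod (2 * int k)"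
    using assms(5) by (simp add: i j mod_eq_dvd_iff split: if_splits)
  then show ?thesis
    using assms(1,2) by (simp add: i j block_indices_def)
qed

lemma normal_words_separated:
  assumes "q \<noteq> 0" "I \<in> normal_indices k n" "J \<in> normal_indices k n"
    and weight: "word_weight q k (normal_word n I) (source n J) \<noteq> 0"
    and target: "moves k (normal_word n I) (source n J) = moves k (normal_word n J) (source n J)"
  shows "I = J"
proof (rule PiE_ext)
  fix a assume a: "a \<in> {1..n}"
  have reduced: "reduced k (\<lambda>_. 0)"
    by (simp add: reduced_def)
  show "I a = J a"
  proof (rule block_index_eqI)
    show "I a \<in> block_indices k" "J a \<in> block_indices k"
      using assms a by (auto simp: normal_indices_def)
    show "row (I a) = row (J a)"
      using weight a by (simp add: source_def word_weight_normal_word_nonzero[OF assms(1) reduced])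
    show "col (I a) = col (J a)"
      "block_shift k (I a) mod (2 * int k) = block_shift k (J a) mod (2 * int k)"
      using target a
      by (auto simp: source_def moves_normal_word[OF reduced] set_eq_iff fun_eq_iff
          split: if_splits)
  qed
qed (use assms(2,3) in \<open>simp_all add: normal_indices_def\<close>)

lemma normal_words_independent:
  fixes q :: "'a::field"
  assumes "q \<noteq> 0"
    and ideal: "(\<Sum>I\<in>normal_indices k n. fsmul (c I) (fword (normal_word n I))) \<in> Cl_ideal q n k"
    and J: "J \<in> normal_indices k n"
  shows "c J = 0"
proof -
  define h where "h \<tau> = (if \<tau> = moves k (normal_word n J) (source n J) then 1 else (0::'a))" for \<tau>
  interpret coeff: Vector_Spaces.linear fsmul "(*)" "matrix_coeff q k h (source n J)"
    by (rule linear_matrix_coeff)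
  have "0 = matrix_coeff q k h (source n J)
      (\<Sum>I\<in>normal_indices k n. fsmul (c I) (fword (normal_word n I)))"
    using matrix_coeff_Cl_ideal[OF ideal assms(1) reduced_source] by simp
  also have "\<dots> = (\<Sum>I\<in>normal_indices k n. c I * act q k (normal_word n I) h (source n J))"
    by (simp add: coeff.sum coeff.scale)
  also have "\<dots> = (\<Sum>I\<in>{J}. c I * act q k (normal_word n I) h (source n J))"
    using J normal_words_separated[OF assms(1) _ J]
    by (intro sum.mono_neutral_right finite_normal_indices) (auto simp: act_def h_def)
  finally have "c J * word_weight q k (normal_word n J) (source n J) = 0"
    by (simp add: act_def h_def)
  moreover have "word_weight q k (normal_word n J) (source n J) \<noteq> 0"
    by (simp add: source_def word_weight_normal_word_nonzero[OF assms(1)] reduced_def)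
  ultimately show ?thesis
    by simp
qed

section \<open>Reduction to normal words\<close>

locale quantum_clifford = presentation n "Cl_rels q n k" for q :: "'a::field" and n k :: nat +
  assumes two_nonzero: "(2::'a) \<noteq> 0" and q_nonzero: "q \<noteq> 0" and k_pos: "0 < k"
begin

notation reduces (infix "\<leadsto>" 50) and proportional (infix "\<approx>" 50)

lemma
  assumes "a \<in> {1..n}" "b \<in> {1..n}"
  shows Om_Om_rel: "fword [Om a, Om b] - fword [Om b, Om a] \<in> ideal"
    and Om_OmI_rel: "fword [Om a, OmI a] - fword [] \<in> ideal"
    and OmI_Om_rel: "fword [OmI a, Om a] - fword [] \<in> ideal"
    and Om_Psi_rel: "fword [Om a, Psi b] - fsmul (q ^ (if a = b then 1 else 0))
      (fword [Psi b, Om a]) \<in> ideal"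
    and Om_PsiS_rel: "fword [Om a, PsiS b] - fsmul (inverse q ^ (if a = b then 1 else 0))
      (fword [PsiS b, Om a]) \<in> ideal"
    and Psi_Psi_rel: "fword [Psi a, Psi b] + fword [Psi b, Psi a] \<in> ideal"
    and PsiS_PsiS_rel: "fword [PsiS a, PsiS b] + fword [PsiS b, PsiS a] \<in> ideal"
    and Psi_PsiS_OmI_rel: "fword [Psi a, PsiS a] + fsmul (q ^ k) (fword [PsiS a, Psi a])
      - fword (replicate k (OmI a)) \<in> ideal"
    and Psi_PsiS_Om_rel: "fword [Psi a, PsiS a] + fsmul (inverse q ^ k) (fword [PsiS a, Psi a])
      - fword (replicate k (Om a)) \<in> ideal"
    and Psi_PsiS_distinct_rel: "a \<noteq> b \<Longrightarrow> fword [Psi a, PsiS b] + fword [PsiS b, Psi a] \<in> ideal"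
  unfolding Cl_rels_words
  by (rule ideal_gen.base, rule UN_I[OF assms(1)], rule UN_I[OF assms(2)], simp)+

lemma Om_OmI:
  assumes "a \<in> {1..n}"
  shows "[Om a, OmI a] \<approx> []" "[OmI a, Om a] \<approx> []"
  using Om_OmI_rel[OF assms assms] OmI_Om_rel[OF assms assms] assms
  by (auto intro!: proportionalI[of _ 1] simp: Gens_def)

lemma Om_commutes:
  assumes "a \<in> {1..n}" "gen_idx g \<in> {1..n}"
  shows "[Om a, g] \<approx> [g, Om a]"
proof -
  have Oms: "[Om b, Om c] \<approx> [Om c, Om b]" if "b \<in> {1..n}" "c \<in> {1..n}" for b c
    using that Om_Om_rel[OF that] by (auto intro!: proportionalI[of _ 1] simp: Gens_def)
  show ?thesis
  proof (cases g)
    case (Psi b)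
    then show ?thesis
      using assms Om_Psi_rel[of a b] q_nonzero by (auto intro!: proportionalI simp: Gens_def)
  next
    case (PsiS b)
    then show ?thesis
      using assms Om_PsiS_rel[of a b] q_nonzero by (auto intro!: proportionalI simp: Gens_def)
  next
    case (Om b)
    then show ?thesis
      using assms Oms by simp
  next
    case (OmI b)
    then show ?thesis
      using assms Oms proportional_inverse_commute[of "[Om b]" "[OmI b]" "[Om a]"] Om_OmI[of b]
      by (simp add: proportional_sym)
  qed
qed

lemma OmI_commutes:
  assumes "a \<in> {1..n}" "gen_idx g \<in> {1..n}"
  shows "[OmI a, g] \<approx> [g, OmI a]"
  using proportional_inverse_commute[of "[Om a]" "[OmI a]" "[g]"] Om_OmI Om_commutes assms by simp

lemma ladders_commute:
  assumes "a \<in> {1..n}" "b \<in> {1..n}" "a \<noteq> b"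
  shows "[ladder a s, ladder b t] \<approx> [ladder b t, ladder a s]"
proof -
  have mixed: "[Psi c, PsiS d] \<approx> [PsiS d, Psi c]" if "c \<in> {1..n}" "d \<in> {1..n}" "c \<noteq> d" for c d
    using that Psi_PsiS_distinct_rel[of c d]
    by (auto intro!: proportionalI[of _ "-1"] simp: Gens_def)
  have "[Psi a, Psi b] \<approx> [Psi b, Psi a]" "[PsiS a, PsiS b] \<approx> [PsiS b, PsiS a]"
    using assms Psi_Psi_rel[of a b] PsiS_PsiS_rel[of a b]
    by (auto intro!: proportionalI[of _ "-1"] simp: Gens_def)
  then show ?thesis
    using assms mixed[of a b] mixed[of b a] by (simp add: ladder_def proportional_sym)
qed

lemma distinct_sites_commute:
  assumes "gen_idx g \<in> {1..n}" "gen_idx h \<in> {1..n}" "gen_idx g \<noteq> gen_idx h"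
  shows "[g, h] \<approx> [h, g]"
proof (cases g rule: gen_cases)
  case (ladder a s)
  then show ?thesis
    using assms ladders_commute Om_commutes OmI_commutes
    by (cases h rule: gen_cases) (simp_all add: proportional_sym)
qed (use assms Om_commutes OmI_commutes in auto)

lemma ladder_square:
  assumes a: "a \<in> {1..n}"
  shows "[ladder a s, ladder a s] \<leadsto> Y"
proof (rule reduces_by_relation)
  have "fsmul 2 f = f + f" for f :: "'a falg"
    using falg.scale_left_distrib[of 1 1 f] by simp
  then show "fsmul 2 (fword [ladder a s, ladder a s]) - 0 \<in> ideal"
    using Psi_Psi_rel[OF a a] PsiS_PsiS_rel[OF a a] by (simp add: ladder_def)
qed (simp_all add: two_nonzero falg.span_zero)

lemma ladder_relation:
  assumes a: "a \<in> {1..n}" and w: "w \<in> {replicate k (Om a), replicate k (OmI a)}"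
  obtains c d where "c \<noteq> 0"
    "fsmul c (fword [ladder a s, ladder a (\<not> s)]) + fsmul d (fword [ladder a (\<not> s), ladder a s])
      - fword w \<in> ideal"
proof -
  define e where "e = (if w = replicate k (Om a) then inverse q ^ k else q ^ k)"
  have "fword [Psi a, PsiS a] + fsmul e (fword [PsiS a, Psi a]) - fword w \<in> ideal"
    using Psi_PsiS_OmI_rel[OF a a] Psi_PsiS_Om_rel[OF a a] w by (auto simp: e_def)
  moreover have "e \<noteq> 0"
    by (simp add: e_def q_nonzero)
  ultimately show ?thesis
    using that[of 1 e] that[of e 1] by (cases s) (simp_all add: ladder_def add.commute)
qed

lemma ladder_pair_reduces:
  assumes a: "a \<in> {1..n}" and w: "w \<in> {replicate k (Om a), replicate k (OmI a)}"
  shows "w \<leadsto> {[ladder a s, ladder a (\<not> s)], [ladder a (\<not> s), ladder a s]}" (is "_ \<leadsto> {?x, ?y}")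
    and "[ladder a s, ladder a (\<not> s)] \<leadsto> {[ladder a (\<not> s), ladder a s], w}"
proof -
  obtain c d where "c \<noteq> 0"
    and rel: "fsmul c (fword ?x) + fsmul d (fword ?y) - fword w \<in> ideal"
    by (rule ladder_relation[OF a w, of s])
  have words: "?x \<in> lists (Gens n)" "?y \<in> lists (Gens n)" "w \<in> lists (Gens n)"
    using a w by (auto simp: ladder_def Gens_def)
  have "fsmul c (fword ?x) + fsmul d (fword ?y) \<in> falg.span (fword ` ({?x, ?y} \<inter> lists (Gens n)))"
    using words by (intro falg.span_add falg.span_scale falg.span_base) auto
  then show "w \<leadsto> {?x, ?y}"
    using falg.subspace_neg[OF subspace_ideal_gen rel] by (intro reduces_by_relation[of 1]) simp_all
  have "fword w - fsmul d (fword ?y) \<in> falg.span (fword ` ({?y, w} \<inter> lists (Gens n)))"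
    using words by (intro falg.span_diff falg.span_scale falg.span_base) auto
  then show "?x \<leadsto> {?y, w}"
    using rel \<open>c \<noteq> 0\<close> by (intro reduces_by_relation[of c]) (simp_all add: algebra_simps)
qed

lemma ladder_sandwich:
  assumes a: "a \<in> {1..n}" and w: "w \<in> {replicate k (Om a), replicate k (OmI a)}"
  shows "[ladder a s, ladder a (\<not> s), ladder a s] \<approx> w @ [ladder a s]" (is "[?p, ?p', ?p] \<approx> _")
proof -
  have zero: "[?p', ?p, ?p] \<leadsto> Y" for Y
    using reduces_context[OF ladder_square[OF a], of "{}" "[?p']" "[]"] by simp
  have "[] @ [?p, ?p'] @ [?p] \<leadsto> {w @ [?p]}"
    by (rule reduces_context[OF ladder_pair_reduces(2)[OF a w]])
       (use zero in \<open>auto intro: reduces_refl\<close>)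
  moreover have "[] @ w @ [?p] \<leadsto> {[?p, ?p', ?p]}"
    by (rule reduces_context[OF ladder_pair_reduces(1)[OF a w]])
       (use zero in \<open>auto intro: reduces_refl\<close>)
  ultimately show ?thesis
    by (simp add: proportional_def)
qed

lemma ladder_period:
  assumes "a \<in> {1..n}"
  shows "replicate (2 * k) (Om a) @ [ladder a s] \<approx> [ladder a s]"
proof -
  let ?o = "replicate k (Om a)" and ?i = "replicate k (OmI a)"
  have "?o @ [ladder a s] \<approx> ?i @ [ladder a s]"
    using ladder_sandwich[OF assms, of ?o s] ladder_sandwich[OF assms, of ?i s]
    by (blast intro: proportional_sym proportional_trans)
  then have "?o @ ?o @ [ladder a s] \<approx> ?o @ ?i @ [ladder a s]"
    using proportional_context[of _ _ ?o "[]"] by simp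
  also have "\<dots> \<approx> [ladder a s]"
    using proportional_context[OF proportional_replicate_cancel[OF Om_OmI(1)[OF assms]], of "[]"]
    by simp
  finally show ?thesis
    by (simp add: mult_2 replicate_add)
qed

lemma unit_word_commutes_Om:
  assumes "a \<in> {1..n}"
  shows "unit_word a s t @ replicate j (Om a) \<approx> replicate j (Om a) @ unit_word a s t"
  using assms Om_commutes[OF assms]
  by (intro proportional_commute) (auto simp: unit_word_def proportional_sym split: if_splits)

lemma unit_word_period:
  assumes "a \<in> {1..n}"
  shows "unit_word a s t @ replicate (2 * k) (Om a) \<approx> unit_word a s t"
proof -
  obtain v where v: "unit_word a s t = ladder a s # v"
    by (simp add: unit_word_def)
  note unit_word_commutes_Om[OF assms]
  also have "replicate (2 * k) (Om a) @ unit_word a s t \<approx> unit_word a s t"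
    using proportional_context[OF ladder_period[OF assms], of "[]" s v] by (simp add: v)
  finally show ?thesis .
qed

lemma unit_word_Om_power_reduces:
  assumes "a \<in> {1..n}"
  shows "unit_word a s t @ replicate j (Om a) \<leadsto> blocks k a"
proof (induction j rule: less_induct)
  case (less j)
  show ?case
  proof (cases "j < 2 * k")
    case True
    then show ?thesis
      unfolding blocks_def
      by (intro reduces_refl image_eqI[of _ _ "(s, t, j)"]) (simp_all add: block_indices_def)
  next
    case False
    then obtain i where j: "j = 2 * k + i"
      using le_Suc_ex by (metis not_less)
    have "unit_word a s t @ replicate j (Om a) \<approx> unit_word a s t @ replicate i (Om a)"
      using proportional_context[OF unit_word_period[OF assms], of "[]" s t "replicate i (Om a)"]
      by (simp add: j replicate_add)
    also have "\<dots> \<leadsto> blocks k a"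
      using less[of i] k_pos by (simp add: j)
    finally show ?thesis .
  qed
qed

lemma Om_block_reduces:
  assumes a: "a \<in> {1..n}"
  shows "Om a # unit_word a s t @ replicate j (Om a) \<leadsto> blocks k a"
proof -
  have "Om a # unit_word a s t @ replicate j (Om a) \<approx> unit_word a s t @ replicate (Suc j) (Om a)"
    using proportional_context[OF proportional_sym[OF unit_word_commutes_Om[OF a, of s t 1]],
        of "[]"] by simp
  also have "\<dots> \<leadsto> blocks k a"
    by (rule unit_word_Om_power_reduces[OF a])
  finally show ?thesis .
qed

lemma OmI_block_reduces:
  assumes a: "a \<in> {1..n}"
  shows "OmI a # unit_word a s t @ replicate j (Om a) \<leadsto> blocks k a"
proof -
  let ?u = "unit_word a s t" and ?o = "\<lambda>i. replicate i (Om a)"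
  have period: "?o (2 * k) = Om a # ?o (2 * k - 1)"
    using k_pos by (simp flip: replicate_Suc)
  have commute: "[OmI a] @ ?u \<approx> ?u @ [OmI a]"
    using a OmI_commutes[OF a]
    by (intro proportional_commute) (auto simp: unit_word_def split: if_splits)
  have "OmI a # ?u @ ?o j \<approx> OmI a # ?u @ ?o (2 * k) @ ?o j"
    using proportional_context[OF proportional_sym[OF unit_word_period[OF a]], of "[OmI a]"] by simp
  also have "\<dots> \<approx> ?u @ [OmI a] @ ?o (2 * k) @ ?o j"
    using proportional_context[OF commute, of "[]" "?o (2 * k) @ ?o j"] by simp
  also have "\<dots> \<approx> ?u @ ?o (2 * k - 1 + j)"
    using proportional_context[OF Om_OmI(2)[OF a], of ?u "?o (2 * k - 1) @ ?o j"]
    by (simp add: period replicate_add)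
  also have "\<dots> \<leadsto> blocks k a"
    by (rule unit_word_Om_power_reduces[OF a])
  finally show ?thesis .
qed

lemma ladder_block_reduces:
  assumes a: "a \<in> {1..n}"
  shows "ladder a r # unit_word a s t @ replicate j (Om a) \<leadsto> blocks k a"
proof (cases "s = r")
  case True
  obtain v where "unit_word a s t = ladder a s # v"
    by (simp add: unit_word_def)
  then show ?thesis
    using reduces_context[OF ladder_square[OF a], of "{}" "[]" "v @ replicate j (Om a)"] True
    by simp
next
  case False
  then have r: "r = (\<not> s)" by simp
  show ?thesis
  proof (cases "s = t")
    case False
    then have "ladder a r # unit_word a s t = unit_word a r r"
      by (simp add: unit_word_def r)
    then show ?thesis
      using unit_word_Om_power_reduces[OF a, of r r j] by (metis append_Cons)
  next
    case True
    let ?o = "\<lambda>i. replicate i (Om a)"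
    have unit: "[ladder a r] = unit_word a r (\<not> r)"
      by (simp add: unit_word_def)
    have "ladder a r # unit_word a s t = [ladder a r, ladder a (\<not> r), ladder a r]"
      using True by (simp add: unit_word_def r)
    also have "\<dots> \<approx> ?o k @ [ladder a r]"
      by (rule ladder_sandwich[OF a]) simp
    also have "\<dots> \<approx> [ladder a r] @ ?o k"
      unfolding unit by (rule proportional_sym[OF unit_word_commutes_Om[OF a]])
    finally have "ladder a r # unit_word a s t \<approx> [ladder a r] @ ?o k" .
    from proportional_context[OF this, of "[]" "?o j"]
    have "ladder a r # unit_word a s t @ ?o j \<approx> unit_word a r (\<not> r) @ ?o (k + j)"
      by (simp add: replicate_add flip: unit)
    also have "\<dots> \<leadsto> blocks k a"
      by (rule unit_word_Om_power_reduces[OF a])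
    finally show ?thesis .
  qed
qed

lemma letter_block_reduces:
  assumes "gen_idx g \<in> {1..n}" "y \<in> blocks k (gen_idx g)"
  shows "g # y \<leadsto> blocks k (gen_idx g)"
proof -
  obtain s t j where "y = unit_word (gen_idx g) s t @ replicate j (Om (gen_idx g))"
    using assms(2) by (auto simp: blocks_def)
  then show ?thesis
    using assms(1) ladder_block_reduces Om_block_reduces OmI_block_reduces
    by (cases g rule: gen_cases) simp_all
qed

lemma Nil_reduces_blocks:
  assumes a: "a \<in> {1..n}"
  shows "[] \<leadsto> blocks k a"
proof -
  let ?o = "replicate k (Om a)" and ?i = "replicate k (OmI a)"
  have "[] \<approx> ?i @ ?o"
    by (rule proportional_sym[OF proportional_replicate_cancel[OF Om_OmI(2)[OF a]]])
  also have "\<dots> \<leadsto> blocks k a"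
  proof (rule reduces_context[where u = "[]", simplified])
    show "?i \<leadsto> {unit_word a True True, unit_word a False False}"
      using ladder_pair_reduces(1)[OF a, of ?i True] by (simp add: unit_word_def)
  qed (use unit_word_Om_power_reduces[OF a] in auto)
  finally show ?thesis .
qed

lemma letter_commutes_normal_word:
  assumes "Suc m \<le> n" "gen_idx g = Suc m" "x \<in> normal_words k m"
  shows "g # x \<approx> x @ [g]"
proof (rule proportional_commute_letter)
  fix h assume "h \<in> set x"
  then have "gen_idx h \<in> {1..m}"
    using assms(3) normal_word_in_lists_Gens by (fastforce simp: normal_words_def Gens_def)
  then show "[g, h] \<approx> [h, g]"
    using assms(1,2) by (intro distinct_sites_commute) auto
qed

lemma letter_normal_word_reduces:
  assumes "m \<le> n" "gen_idx g \<in> {1..m}" "x \<in> normal_words k m"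
  shows "g # x \<leadsto> normal_words k m"
  using assms
proof (induction m arbitrary: x)
  case (Suc m)
  then obtain x' y
    where x: "x = x' @ y" and x': "x' \<in> normal_words k m" and y: "y \<in> blocks k (Suc m)"
    by (auto simp: normal_words_Suc)
  show ?case
  proof (cases "gen_idx g = Suc m")
    case True
    from proportional_context[OF letter_commutes_normal_word[OF Suc.prems(1) True x'], of "[]" y]
    have "g # x \<approx> x' @ g # y"
      by (simp add: x)
    also have "\<dots> \<leadsto> normal_words k (Suc m)"
    proof (rule reduces_context[where v = "[]", simplified])
      show "g # y \<leadsto> blocks k (Suc m)"
        using letter_block_reduces[of g y] True Suc.prems y by simp
    qed (use x' in \<open>auto simp: normal_words_Suc intro!: reduces_refl\<close>)
    finally show ?thesis .
  next
    case False
    have "(g # x') @ y \<leadsto> normal_words k (Suc m)"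
    proof (rule reduces_context[where u = "[]", unfolded append_Nil])
      show "g # x' \<leadsto> normal_words k m"
        using Suc False x' by auto
    qed (use y in \<open>auto simp: normal_words_Suc intro!: reduces_refl\<close>)
    then show ?thesis by (simp add: x)
  qed
qed simp

lemma Nil_reduces_normal_words: "m \<le> n \<Longrightarrow> [] \<leadsto> normal_words k m"
proof (induction m)
  case (Suc m)
  show ?case
  proof (rule reduces_trans)
    show "[] \<leadsto> normal_words k m"
      using Suc by simp
    fix x assume x: "x \<in> normal_words k m"
    have "x @ [] @ [] \<leadsto> normal_words k (Suc m)"
      by (rule reduces_context[OF Nil_reduces_blocks[of "Suc m"]])
         (use Suc.prems x in \<open>auto simp: normal_words_Suc intro!: reduces_refl\<close>)
    then show "x \<leadsto> normal_words k (Suc m)" by simp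
  qed
qed (simp add: normal_words_0 reduces_refl)

lemma word_reduces_normal_words: "w \<in> lists (Gens n) \<Longrightarrow> w \<leadsto> normal_words k n"
proof (induction w)
  case (Cons g w)
  then have "[g] @ w @ [] \<leadsto> normal_words k n"
    by (intro reduces_context[of w "normal_words k n"])
       (auto intro!: letter_normal_word_reduces simp: Gens_def)
  then show ?case by simp
qed (simp add: Nil_reduces_normal_words)

lemma FA_subset_span_normal_words:
  "FA n \<subseteq> falg.span (Cl_ideal q n k \<union> fword ` normal_words k n)"
  unfolding Cl_ideal_def
proof (rule FA_minimal)
  fix w assume "w \<in> lists (Gens n)"
  then have "fword w \<in> falg.span (ideal \<union> fword ` (normal_words k n \<inter> lists (Gens n)))"
    using word_reduces_normal_words by (simp add: reduces_def)
  also have "\<dots> \<subseteq> falg.span (ideal \<union> fword ` normal_words k n)"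
    by (intro falg.span_mono) blast
  finally show "fword w \<in> falg.span (ideal \<union> fword ` normal_words k n)" .
qed simp

end

theorem corollary3p5:
  fixes q :: "'a::field" and n k :: nat
  assumes "(2::'a) \<noteq> 0" and "q \<noteq> 0" and "0 < n" and "0 < k"
  shows "quotient_dim_eq n (Cl_ideal q n k) ((8 * k) ^ n)"
proof -
  interpret quantum_clifford q n k
    using assms by unfold_locales
  have "quotient_dim_eq n (Cl_ideal q n k) (card (normal_indices k n))"
  proof (rule quotient_dim_eqI[OF subspace_Cl_ideal finite_normal_indices])
    show "(\<lambda>I. fword (normal_word n I)) ` normal_indices k n \<subseteq> FA n"
      using normal_word_in_lists_Gens fword_in_FA by blast
    show "FA n \<subseteq> falg.span (Cl_ideal q n k \<union> (\<lambda>I. fword (normal_word n I)) ` normal_indices k n)"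
      using FA_subset_span_normal_words by (simp add: normal_words_def image_image)
  qed (rule normal_words_independent[OF assms(2)])
  then show ?thesis
    by (simp only: card_normal_indices)
qed

end
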